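(* Let $M=(M_n)_{n\in\mathbb{N}}$ be a discrete-time normal martingale with the chaotic representation property. Let $F$ be a (complex-valued) function on $\Gamma$ satisfying $$|F(\sigma)|\le C\lambda_\sigma^p,\quad \sigma\in\Gamma,$$ for some constants $C\ge0$ and $p\ge0$. Then there exists a unique $\Phi\in\mathcal{S}^*(M)$ such that $F=\widehat{\Phi}$, where $\widehat{\Phi}$ is the Fock transform of $\Phi$.
   Context: $\mathbb{N}$ is the set of nonnegative integers and $\Gamma$ is the (countably infinite) set of all finite subsets of $\mathbb{N}$. $(\Omega,\mathcal{F},P)$ is a probability space; $\langle\cdot,\cdot\rangle$ and $\|\cdot\|$ are the inner product (conjugate-linear in the first argument, linear in the second) and norm of the Hilbert space $\mathcal{L}^2(\Omega,\mathcal{F},P)$ of complex-valued square integrable functions. A real-valued square integrable process $M=(M_n)_{n\in\mathbb{N}}$ on $(\Omega,\mathcal{F},P)$ is a discrete-time normal martingale if, with $\mathcal{F}_{-1}=\{\emptyset,\Omega\}$ and $\mathcal{F}_n=\sigma(M_k;0\le k\le n)$: (i) $\mathbb{E}[M_0|\mathcal{F}_{-1}]=0$ and $\mathbb{E}[M_n|\mathcal{F}_{n-1}]=M_{n-1}$ for $n\ge1$; (ii) $\mathbb{E}[M_0^2|\mathcal{F}_{-1}]=1$ and $\mathbb{E}[M_n^2|\mathcal{F}_{n-1}]=M_{n-1}^2+1$ for $n\ge1$. Put $Z_0=M_0$, $Z_n=M_n-M_{n-1}$ for $n\ge1$, $Z_\emptyset=1$, and $Z_\sigma=\prod_{i\in\sigma}Z_i$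 for nonempty $\sigma\in\Gamma$; $\{Z_\sigma\mid\sigma\in\Gamma\}$ is an orthonormal system in $\mathcal{L}^2(\Omega,\mathcal{F},P)$. Let $\mathcal{F}_\infty=\sigma(M_n;n\in\mathbb{N})$ and $\mathcal{L}^2(M)=\mathcal{L}^2(\Omega,\mathcal{F}_\infty,P)$. $M$ has the chaotic representation property if $\{Z_\sigma\mid\sigma\in\Gamma\}$ is total in $\mathcal{L}^2(M)$ (hence an orthonormal basis of it). Let $\lambda_\emptyset=1$ and $\lambda_\sigma=\prod_{k\in\sigma}(k+1)$ for nonempty $\sigma\in\Gamma$. For $p\ge0$ put $\|\xi\|_p^2=\sum_{\sigma\in\Gamma}\lambda_\sigma^{2p}|\langle Z_\sigma,\xi\rangle|^2$ for $\xi\in\mathcal{L}^2(M)$, and $\mathcal{S}_p(M)=\{\xi\in\mathcal{L}^2(M)\mid\|\xi\|_p<\infty\}$, a Hilbert space with norm $\|\cdot\|_p$. Let $\mathcal{S}(M)=\bigcap_{p=0}^\infty\mathcal{S}_p(M)$ with the topology generated by the norms $\{\|\cdot\|_p\}_{p\ge0}$; all $Z_\sigma$ belong to $\mathcal{S}(M)$. $\mathcal{S}^*(M)$ is the dual of $\mathcal{S}(M)$ (continuous linear functionals); its elements are called generalized functionals of $M$. The Fock transform of $\Phi\in\mathcal{S}^*(M)$ is the function $\widehat{\Phi}$ on $\Gamma$ given by $\widehat{\Phi}(\sigma)=\Phi(Z_\sigma)$, $\sigma\in\Gamma$. *)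

theory Defs
  imports "HOL-Probability.Probability"
begin

definition fin_subsets :: "nat set set" where
  "fin_subsets = {\<sigma>. finite \<sigma>}"

definition gen_alg :: "'a measure \<Rightarrow> (nat \<Rightarrow> 'a \<Rightarrow> real) \<Rightarrow> nat set \<Rightarrow> 'a measure" where
  "gen_alg P M K = sigma (space P) {M k -` B \<inter> space P | k B. k \<in> K \<and> B \<in> sets borel}"

definition normal_martingale :: "'a measure \<Rightarrow> (nat \<Rightarrow> 'a \<Rightarrow> real) \<Rightarrow> bool" where
  "normal_martingale P M \<longleftrightarrow>
     (\<forall>n. M n \<in> borel_measurable P \<and> integrable P (\<lambda>x. (M n x)\<^sup>2)) \<and>
     (AE x in P. real_cond_exp P (sigma (space P) {}) (M 0) x = 0) \<and>
     (\<forall>n\<ge>1. AE x in P. real_cond_exp P (gen_alg P M {..n - 1}) (M n) x = M (n - 1) x) \<and>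
     (AE x in P. real_cond_exp P (sigma (space P) {}) (\<lambda>y. (M 0 y)\<^sup>2) x = 1) \<and>
     (\<forall>n\<ge>1. AE x in P. real_cond_exp P (gen_alg P M {..n - 1}) (\<lambda>y. (M n y)\<^sup>2) x
                        = (M (n - 1) x)\<^sup>2 + 1)"

definition increment :: "(nat \<Rightarrow> 'a \<Rightarrow> real) \<Rightarrow> nat \<Rightarrow> 'a \<Rightarrow> real" where
  "increment M n x = (if n = 0 then M 0 x else M n x - M (n - 1) x)"

definition Z_prod :: "(nat \<Rightarrow> 'a \<Rightarrow> real) \<Rightarrow> nat set \<Rightarrow> 'a \<Rightarrow> complex" where
  "Z_prod M \<sigma> x = complex_of_real (\<Prod>i\<in>\<sigma>. increment M i x)"

text \<open>As usual in the library, elements of an \<open>L\<^sup>2\<close> space are represented by square integrable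
  functions rather than by their classes modulo almost everywhere equality; \<open>L2_norm\<close> and
  \<open>p_norm\<close> below depend only on the class of their argument. See \<open>gen_functional_cong_AE\<close>
  for why this makes no difference to the continuous linear functionals.\<close>

definition L2_space :: "'a measure \<Rightarrow> ('a \<Rightarrow> complex) set" where
  "L2_space N = {\<xi>. \<xi> \<in> borel_measurable N \<and> integrable N (\<lambda>x. (cmod (\<xi> x))\<^sup>2)}"

definition L2_inner :: "'a measure \<Rightarrow> ('a \<Rightarrow> complex) \<Rightarrow> ('a \<Rightarrow> complex) \<Rightarrow> complex" where
  "L2_inner N \<xi> \<eta> = (LINT x|N. cnj (\<xi> x) * \<eta> x)"

definition L2_norm :: "'a measure \<Rightarrow> ('a \<Rightarrow> complex) \<Rightarrow> real" where
  "L2_norm N \<xi> = sqrt (LINT x|N. (cmod (\<xi> x))\<^sup>2)"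

definition L2M :: "'a measure \<Rightarrow> (nat \<Rightarrow> 'a \<Rightarrow> real) \<Rightarrow> ('a \<Rightarrow> complex) set" where
  "L2M P M = L2_space (restr_to_subalg P (gen_alg P M UNIV))"

text \<open>Totality: the finite linear combinations of the \<open>Z_prod M \<sigma>\<close> are dense in \<open>L2M P M\<close>.\<close>

definition chaotic_representation :: "'a measure \<Rightarrow> (nat \<Rightarrow> 'a \<Rightarrow> real) \<Rightarrow> bool" where
  "chaotic_representation P M \<longleftrightarrow>
     (\<forall>\<xi>\<in>L2M P M. \<forall>\<epsilon>>0. \<exists>A c. finite A \<and> A \<subseteq> fin_subsets \<and>
        L2_norm P (\<lambda>x. \<xi> x - (\<Sum>\<sigma>\<in>A. c \<sigma> * Z_prod M \<sigma> x)) < \<epsilon>)"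

definition weight :: "nat set \<Rightarrow> real" where
  "weight \<sigma> = (\<Prod>k\<in>\<sigma>. real k + 1)"

text \<open>The value of \<open>p_norm\<close> is meaningful only on \<open>Sp_space\<close>, where the series converges.\<close>

definition p_norm :: "'a measure \<Rightarrow> (nat \<Rightarrow> 'a \<Rightarrow> real) \<Rightarrow> real \<Rightarrow> ('a \<Rightarrow> complex) \<Rightarrow> real" where
  "p_norm P M p \<xi> =
     sqrt (\<Sum>\<^sub>\<infinity>\<sigma>\<in>fin_subsets. weight \<sigma> powr (2 * p) * (cmod (L2_inner P (Z_prod M \<sigma>) \<xi>))\<^sup>2)"

definition Sp_space :: "'a measure \<Rightarrow> (nat \<Rightarrow> 'a \<Rightarrow> real) \<Rightarrow> real \<Rightarrow> ('a \<Rightarrow> complex) set" where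
  "Sp_space P M p = {\<xi> \<in> L2M P M.
     (\<lambda>\<sigma>. weight \<sigma> powr (2 * p) * (cmod (L2_inner P (Z_prod M \<sigma>) \<xi>))\<^sup>2) summable_on fin_subsets}"

definition S_space :: "'a measure \<Rightarrow> (nat \<Rightarrow> 'a \<Rightarrow> real) \<Rightarrow> ('a \<Rightarrow> complex) set" where
  "S_space P M = (\<Inter>p::nat. Sp_space P M (real p))"

definition S_topology :: "'a measure \<Rightarrow> (nat \<Rightarrow> 'a \<Rightarrow> real) \<Rightarrow> ('a \<Rightarrow> complex) topology" where
  "S_topology P M = topology_generated_by
     {{\<eta> \<in> S_space P M. p_norm P M p (\<lambda>x. \<eta> x - \<xi> x) < \<epsilon>} | \<xi> p \<epsilon>.
        \<xi> \<in> S_space P M \<and> 0 \<le> p \<and> 0 < \<epsilon>}"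

text \<open>Functionals are extensional, i.e. \<open>undefined\<close> outside \<open>S_space P M\<close>, so that equality of
  HOL functions is equality of functionals on that space.\<close>

definition gen_functionals ::
  "'a measure \<Rightarrow> (nat \<Rightarrow> 'a \<Rightarrow> real) \<Rightarrow> (('a \<Rightarrow> complex) \<Rightarrow> complex) set" where
  "gen_functionals P M = {\<Phi> \<in> extensional (S_space P M).
     (\<forall>\<xi>\<in>S_space P M. \<forall>\<eta>\<in>S_space P M. \<Phi> (\<lambda>x. \<xi> x + \<eta> x) = \<Phi> \<xi> + \<Phi> \<eta>) \<and>
     (\<forall>c. \<forall>\<xi>\<in>S_space P M. \<Phi> (\<lambda>x. c * \<xi> x) = c * \<Phi> \<xi>) \<and>
     continuous_map (S_topology P M) euclidean \<Phi>}"

definition fock_transform ::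
  "(nat \<Rightarrow> 'a \<Rightarrow> real) \<Rightarrow> (('a \<Rightarrow> complex) \<Rightarrow> complex) \<Rightarrow> nat set \<Rightarrow> complex" where
  "fock_transform M \<Phi> \<sigma> = \<Phi> (Z_prod M \<sigma>)"

lemma topspace_S_topology: "topspace (S_topology P M) = S_space P M"
proof -
  have "\<xi> \<in> {\<eta> \<in> S_space P M. p_norm P M 0 (\<lambda>x. \<eta> x - \<xi> x) < 1}" if "\<xi> \<in> S_space P M" for \<xi>
    using that by (simp add: p_norm_def L2_inner_def)
  then show ?thesis
    unfolding S_topology_def topology_generated_by_topspace
    by (intro equalityI subsetI) (fastforce, use zero_less_one in blast)
qed

lemma gen_functional_cong_AE:
  assumes nm: "normal_martingale P M"
    and \<Phi>: "\<Phi> \<in> gen_functionals P M"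
    and \<xi>: "\<xi> \<in> S_space P M" and \<eta>: "\<eta> \<in> S_space P M"
    and eq: "AE x in P. \<xi> x = \<eta> x"
  shows "\<Phi> \<xi> = \<Phi> \<eta>"
proof (rule ccontr)
  assume neq: "\<Phi> \<xi> \<noteq> \<Phi> \<eta>"
  have M[measurable]: "M n \<in> borel_measurable P" for n
    using nm by (auto simp: normal_martingale_def)
  have Z[measurable]: "Z_prod M \<sigma> \<in> borel_measurable P" for \<sigma>
    unfolding Z_prod_def increment_def by measurable
  have cZ[measurable]: "(\<lambda>x. cnj (Z_prod M \<sigma> x)) \<in> borel_measurable P" for \<sigma>
    unfolding Z_prod_def increment_def complex_cnj_complex_of_real by measurable
  have "{M k -` B \<inter> space P | k B. k \<in> UNIV \<and> B \<in> sets borel} \<subseteq> sets P"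
    using M by (auto intro: measurable_sets)
  then have "sets (gen_alg P M UNIV) \<subseteq> sets P"
    using sets.sigma_sets_subset[of "{M k -` B \<inter> space P | k B. k \<in> UNIV \<and> B \<in> sets borel}" P]
      sets.space_closed[of P]
    unfolding gen_alg_def by (subst sets_measure_of) blast+
  then have "subalgebra P (gen_alg P M UNIV)"
    by (simp add: subalgebra_def gen_alg_def space_measure_of_conv)
  then have sub: "subalgebra P (restr_to_subalg P (gen_alg P M UNIV))"
    by (simp add: subalgebra_def space_restr_to_subalg sets_restr_to_subalg)
  have meas: "\<zeta> \<in> borel_measurable P" if "\<zeta> \<in> S_space P M" for \<zeta>
  proof -
    have "\<zeta> \<in> borel_measurable (restr_to_subalg P (gen_alg P M UNIV))"
      using that unfolding S_space_def Sp_space_def L2M_def L2_space_def by blast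
    then show ?thesis by (rule measurable_from_subalg[OF sub])
  qed
  have norm_eq: "p_norm P M p (\<lambda>x. \<xi> x - \<zeta> x) = p_norm P M p (\<lambda>x. \<eta> x - \<zeta> x)"
    if "\<zeta> \<in> S_space P M" for \<zeta> p
  proof -
    note [measurable] = meas[OF \<xi>] meas[OF \<eta>] meas[OF that]
    have "L2_inner P (Z_prod M \<sigma>) (\<lambda>x. \<xi> x - \<zeta> x) = L2_inner P (Z_prod M \<sigma>) (\<lambda>x. \<eta> x - \<zeta> x)" for \<sigma>
      unfolding L2_inner_def by (rule integral_cong_AE) (measurable, use eq in auto)
    then show ?thesis by (simp add: p_norm_def)
  qed
  have open_cong: "\<xi> \<in> U \<longleftrightarrow> \<eta> \<in> U" if "openin (S_topology P M) U" for U
    using openin_topology_generated_by[OF that[unfolded S_topology_def]]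
    by induction (use norm_eq \<xi> \<eta> in auto)
  have "openin (S_topology P M) {\<zeta> \<in> topspace (S_topology P M). \<Phi> \<zeta> \<in> - {\<Phi> \<eta>}}"
    using \<Phi> by (intro openin_continuous_map_preimage[where Y = euclidean])
      (auto simp: gen_functionals_def open_Compl)
  from open_cong[OF this] show False
    using \<xi> \<eta> neq by (simp add: topspace_S_topology)
qed

end

theory Submission
  imports Defs
begin

text \<open>Everything is controlled by the coefficients \<open>\<langle>Z\<^sub>\<sigma>, \<xi>\<rangle>\<close> of a test functional \<open>\<xi>\<close>.
  The increments of a normal martingale have conditional mean 0 and conditional second moment 1
  given the past, so the products \<open>Z\<^sub>\<sigma>\<close> are orthonormal (\<open>Z_prod_orthonormal\<close>); in particular
  each \<open>Z\<^sub>\<sigma>\<close> is a test functional whose only nonzero coefficient is the one at \<open>\<sigma>\<close>.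

  Existence. The candidate is \<open>\<Phi> \<xi> = (\<Sum>\<sigma>. F \<sigma> * \<langle>Z\<^sub>\<sigma>, \<xi>\<rangle>)\<close>, which takes the value \<open>F \<sigma>\<close> at
  \<open>Z\<^sub>\<sigma>\<close> by orthonormality. What makes the series converge is that \<open>\<Sum>\<sigma>. \<lambda>\<^sub>\<sigma>\<^sup>-\<^sup>2\<close> is finite: it is
  the expansion of the convergent product of the factors \<open>1 + 1 / (k + 1)\<^sup>2\<close>. Trading one power of the weight
  for this sum in the Cauchy-Schwarz inequality gives \<open>\<bar>\<Phi> \<xi>\<bar> \<le> 2 * C * \<parallel>\<xi>\<parallel>\<^sub>p\<^sub>+\<^sub>1\<close>
  (\<open>norm_dual_pairing_le\<close>), hence both convergence and continuity.

  Uniqueness. The partial sums \<open>\<Sum>\<sigma>\<in>A. \<langle>Z\<^sub>\<sigma>, \<xi>\<rangle> Z\<^sub>\<sigma>\<close> converge to \<open>\<xi>\<close> in the topology of the test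
  functionals (\<open>chaos_expansion_limitin\<close>), because the norms see only the coefficients and the
  partial sums truncate these. A continuous linear functional is therefore the sum of its
  values at the \<open>Z\<^sub>\<sigma>\<close> against the coefficients (\<open>gen_functional_has_sum\<close>), and its Fock
  transform determines it.\<close>

section \<open>Square integrable functions\<close>

lemma integrable_mult_of_square_integrable:
  fixes f g :: "'a \<Rightarrow> 'b::{real_normed_field, second_countable_topology, banach}"
  assumes [measurable]: "f \<in> borel_measurable N" "g \<in> borel_measurable N"
    and "integrable N (\<lambda>x. (norm (f x))\<^sup>2)" "integrable N (\<lambda>x. (norm (g x))\<^sup>2)"
  shows "integrable N (\<lambda>x. f x * g x)"
proof (rule Bochner_Integration.integrable_bound)
  show "integrable N (\<lambda>x. (norm (f x))\<^sup>2 + (norm (g x))\<^sup>2)"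
    using assms by simp
  have "norm (f x * g x) \<le> norm ((norm (f x))\<^sup>2 + (norm (g x))\<^sup>2)" for x
  proof -
    have "2 * (norm (f x) * norm (g x)) \<le> (norm (f x))\<^sup>2 + (norm (g x))\<^sup>2"
      using sum_squares_bound[of "norm (f x)" "norm (g x)"] by simp
    moreover have "0 \<le> norm (f x) * norm (g x)" by simp
    ultimately have "norm (f x) * norm (g x) \<le> (norm (f x))\<^sup>2 + (norm (g x))\<^sup>2" by linarith
    then show ?thesis by (simp add: norm_mult)
  qed
  then show "AE x in N. norm (f x * g x) \<le> norm ((norm (f x))\<^sup>2 + (norm (g x))\<^sup>2)" by simp
qed measurable

lemma L2_space_inner_integrable:
  assumes "f \<in> L2_space N" "g \<in> L2_space N"
  shows "integrable N (\<lambda>x. cnj (f x) * g x)"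
proof -
  have [measurable]: "f \<in> borel_measurable N" using assms by (simp add: L2_space_def)
  have "(\<lambda>x. cnj (f x)) \<in> borel_measurable N"
    by (rule borel_measurable_continuous_on[where g = f]) (auto intro: continuous_intros)
  then show ?thesis
    using assms by (intro integrable_mult_of_square_integrable) (auto simp: L2_space_def)
qed

lemma L2_space_add:
  assumes "f \<in> L2_space N" "g \<in> L2_space N"
  shows "(\<lambda>x. f x + g x) \<in> L2_space N"
proof -
  have [measurable]: "f \<in> borel_measurable N" "g \<in> borel_measurable N"
    using assms by (simp_all add: L2_space_def)
  have "integrable N (\<lambda>x. (cmod (f x + g x))\<^sup>2)"
  proof (rule Bochner_Integration.integrable_bound)
    show "integrable N (\<lambda>x. 2 * (cmod (f x))\<^sup>2 + 2 * (cmod (g x))\<^sup>2)"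
      using assms by (simp add: L2_space_def)
    show "AE x in N. norm ((cmod (f x + g x))\<^sup>2) \<le> norm (2 * (cmod (f x))\<^sup>2 + 2 * (cmod (g x))\<^sup>2)"
    proof (rule AE_I2)
      fix x
      have "(cmod (f x + g x))\<^sup>2 \<le> (cmod (f x) + cmod (g x))\<^sup>2"
        by (intro power_mono norm_triangle_ineq) auto
      also have "\<dots> \<le> 2 * (cmod (f x))\<^sup>2 + 2 * (cmod (g x))\<^sup>2"
        using sum_squares_bound[of "cmod (f x)" "cmod (g x)"] by (simp add: power2_sum)
      finally show "norm ((cmod (f x + g x))\<^sup>2) \<le> norm (2 * (cmod (f x))\<^sup>2 + 2 * (cmod (g x))\<^sup>2)"
        by simp
    qed
  qed measurable
  then show ?thesis by (simp add: L2_space_def)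
qed

lemma L2_space_cmult:
  assumes "f \<in> L2_space N"
  shows "(\<lambda>x. c * f x) \<in> L2_space N"
  using assms by (auto simp: L2_space_def norm_mult power_mult_distrib)

lemma L2_inner_add:
  assumes "f \<in> L2_space N" "g \<in> L2_space N" "h \<in> L2_space N"
  shows "L2_inner N f (\<lambda>x. g x + h x) = L2_inner N f g + L2_inner N f h"
  using L2_space_inner_integrable[OF assms(1,2)] L2_space_inner_integrable[OF assms(1,3)]
  by (simp add: L2_inner_def distrib_left)

lemma L2_inner_cmult:
  "L2_inner N f (\<lambda>x. c * g x) = c * L2_inner N f g"
proof -
  have "L2_inner N f (\<lambda>x. c * g x) = (LINT x|N. c * (cnj (f x) * g x))"
    unfolding L2_inner_def by (intro Bochner_Integration.integral_cong) (auto simp: ac_simps)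
  then show ?thesis by (simp add: L2_inner_def)
qed

section \<open>Weights\<close>

lemma weight_ge_1: "1 \<le> weight \<sigma>"
  unfolding weight_def by (rule prod_ge_1) simp

lemma weight_powr_pos [simp]: "0 < weight \<sigma> powr p"
  using weight_ge_1[of \<sigma>] by simp

text \<open>An explicit bound that survives the induction: the ratio of consecutive right-hand sides
  dominates the next factor, because, with \<open>m = n + 2\<close>, the comparison comes down to
  \<open>m ^ 4 - 1 \<le> m ^ 4\<close>.\<close>

lemma prod_one_plus_inverse_square_le:
  "(\<Prod>k\<le>n. 1 + (1 / (real k + 1))\<^sup>2) \<le> 4 * (real n + 1) / (real n + 2)"
proof (induction n)
  case (Suc n)
  define m where "m = real n + 2"
  have m: "m > 1" by (simp add: m_def)
  have "(\<Prod>k\<le>Suc n. 1 + (1 / (real k + 1))\<^sup>2) \<le> 4 * (m - 1) / m * (1 + (1 / m)\<^sup>2)"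
    using mult_right_mono[OF Suc.IH, of "1 + (1 / m)\<^sup>2"] by (simp add: m_def add_ac)
  also have "\<dots> = 4 * ((m - 1) * (m\<^sup>2 + 1)) / m ^ 3"
    using m by (simp add: field_simps power2_eq_square power3_eq_cube)
  also have "\<dots> \<le> 4 * m / (m + 1)"
  proof -
    have "(m - 1) * (m\<^sup>2 + 1) * (m + 1) \<le> m * m ^ 3"
      by (simp add: algebra_simps power2_eq_square power3_eq_cube)
    then have "4 * ((m - 1) * (m\<^sup>2 + 1)) * (m + 1) \<le> 4 * m * m ^ 3" by linarith
    then show ?thesis using m by (subst pos_divide_le_eq) (auto simp: pos_le_divide_eq mult.commute)
  qed
  finally show ?case by (simp add: m_def add_ac)
qed simp

text \<open>Multiplying out a product of factors \<open>1 + b k\<close> over \<open>k \<le> n\<close> yields one term for each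
  subset of \<open>{..n}\<close>. With \<open>b k = 1 / (k + 1)\<^sup>2\<close> the term of \<open>\<sigma>\<close> is \<open>1 / \<lambda>\<^sub>\<sigma>\<^sup>2\<close>, so the bound on the
  finite products bounds every finite sum of these terms.\<close>

lemma sum_inverse_weight_square_le:
  assumes A: "finite A" "A \<subseteq> fin_subsets"
  shows "(\<Sum>\<sigma>\<in>A. (1 / weight \<sigma>)\<^sup>2) \<le> 4"
proof -
  have "finite (\<Union>A)" using A by (auto simp: fin_subsets_def)
  then obtain n where n: "\<Union>A \<subseteq> {..<n}"
    using finite_nat_iff_bounded by blast
  have "A \<subseteq> Pow {..n}" using n by fastforce
  then have "(\<Sum>\<sigma>\<in>A. (1 / weight \<sigma>)\<^sup>2) \<le> (\<Sum>\<sigma>\<in>Pow {..n}. (1 / weight \<sigma>)\<^sup>2)"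
    by (intro sum_mono2) auto
  also have "\<dots> = (\<Sum>\<sigma>\<in>Pow {..n}. (\<Prod>k\<in>\<sigma>. (1 / (real k + 1))\<^sup>2) * (\<Prod>k\<in>{..n} - \<sigma>. 1))"
    by (intro sum.cong refl) (simp add: weight_def prod_dividef prod_power_distrib power_divide)
  also have "\<dots> = (\<Prod>k\<le>n. (1 / (real k + 1))\<^sup>2 + 1)"
    by (rule prod_add[symmetric]) simp
  also have "\<dots> = (\<Prod>k\<le>n. 1 + (1 / (real k + 1))\<^sup>2)"
    by (simp add: add.commute)
  also have "\<dots> \<le> 4 * (real n + 1) / (real n + 2)"
    by (rule prod_one_plus_inverse_square_le)
  also have "\<dots> \<le> 4" by (simp add: divide_le_eq)
  finally show ?thesis .
qed

text \<open>Cauchy-Schwarz after writing \<open>\<lambda>\<^sub>\<sigma> powr p\<close> as \<open>1 / \<lambda>\<^sub>\<sigma>\<close> times \<open>\<lambda>\<^sub>\<sigma> powr (p + 1)\<close>. The square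
  sum of the first factors is at most 4, which is the source of the constant 2.\<close>

lemma weighted_Cauchy_Schwarz:
  fixes a F :: "nat set \<Rightarrow> complex"
  assumes growth: "\<forall>\<sigma>\<in>fin_subsets. cmod (F \<sigma>) \<le> C * weight \<sigma> powr p" and C: "C \<ge> 0"
    and A: "finite A" "A \<subseteq> fin_subsets"
  shows "(\<Sum>\<sigma>\<in>A. cmod (F \<sigma> * a \<sigma>))
    \<le> 2 * C * sqrt (\<Sum>\<sigma>\<in>A. weight \<sigma> powr (2 * (p + 1)) * (cmod (a \<sigma>))\<^sup>2)"
proof -
  let ?u = "\<lambda>\<sigma>. 1 / weight \<sigma>" and ?v = "\<lambda>\<sigma>. weight \<sigma> powr (p + 1) * cmod (a \<sigma>)"
  have w: "0 < weight \<sigma>" for \<sigma> using weight_ge_1[of \<sigma>] by simp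
  have sq: "(weight \<sigma> powr (p + 1))\<^sup>2 = weight \<sigma> powr (2 * (p + 1))" for \<sigma>
    by (simp add: power2_eq_square flip: powr_add)
  have "(\<Sum>\<sigma>\<in>A. cmod (F \<sigma> * a \<sigma>)) \<le> (\<Sum>\<sigma>\<in>A. C * (\<bar>?u \<sigma>\<bar> * \<bar>?v \<sigma>\<bar>))"
  proof (rule sum_mono)
    fix \<sigma> assume "\<sigma> \<in> A"
    then have "cmod (F \<sigma>) * cmod (a \<sigma>) \<le> (C * weight \<sigma> powr p) * cmod (a \<sigma>)"
      using growth A by (intro mult_right_mono) auto
    also have "\<dots> = C * (\<bar>?u \<sigma>\<bar> * \<bar>?v \<sigma>\<bar>)"
      using w[of \<sigma>] by (simp add: powr_add)
    finally show "cmod (F \<sigma> * a \<sigma>) \<le> C * (\<bar>?u \<sigma>\<bar> * \<bar>?v \<sigma>\<bar>)"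
      by (simp add: norm_mult)
  qed
  also have "\<dots> = C * (\<Sum>\<sigma>\<in>A. \<bar>?u \<sigma>\<bar> * \<bar>?v \<sigma>\<bar>)"
    by (simp add: sum_distrib_left)
  also have "\<dots> \<le> C * (L2_set ?u A * L2_set ?v A)"
    by (intro mult_left_mono L2_set_mult_ineq C)
  also have "\<dots> \<le> C * (2 * L2_set ?v A)"
  proof (intro mult_left_mono mult_right_mono C)
    show "L2_set ?u A \<le> 2"
      unfolding L2_set_def using sum_inverse_weight_square_le[OF A] by (simp add: real_le_lsqrt)
  qed simp
  also have "L2_set ?v A = sqrt (\<Sum>\<sigma>\<in>A. weight \<sigma> powr (2 * (p + 1)) * (cmod (a \<sigma>))\<^sup>2)"
    unfolding L2_set_def by (simp only: power_mult_distrib sq)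
  finally show ?thesis by simp
qed

section \<open>Orthonormality of the products of increments\<close>

locale normal_martingale_space = prob_space P
  for P :: "'a measure" and M :: "nat \<Rightarrow> 'a \<Rightarrow> real" +
  assumes normal: "normal_martingale P M"
begin

lemma measurable_M [measurable]: "M n \<in> borel_measurable P"
  and square_integrable_M: "integrable P (\<lambda>x. (M n x)\<^sup>2)"
  using normal by (auto simp: normal_martingale_def)

lemma measurable_increment [measurable]: "increment M n \<in> borel_measurable P"
  unfolding increment_def by measurable

lemma subalgebra_gen_alg: "subalgebra P (gen_alg P M K)"
proof -
  have "{M k -` B \<inter> space P | k B. k \<in> K \<and> B \<in> sets borel} \<subseteq> sets P"
    by (auto intro: measurable_sets)
  then have "sets (gen_alg P M K) \<subseteq> sets P"
    using sets.sigma_sets_subset[of "{M k -` B \<inter> space P | k B. k \<in> K \<and> B \<in> sets borel}" P]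
      sets.space_closed[of P]
    unfolding gen_alg_def by (subst sets_measure_of) blast+
  then show ?thesis
    by (simp add: subalgebra_def gen_alg_def space_measure_of_conv)
qed

lemma measurable_gen_alg:
  assumes "k \<in> K"
  shows "M k \<in> borel_measurable (gen_alg P M K)"
proof (rule measurableI)
  fix B :: "real set" assume B: "B \<in> sets borel"
  have "{M k -` B \<inter> space P | k B. k \<in> K \<and> B \<in> sets borel} \<subseteq> Pow (space P)" by auto
  then show "M k -` B \<inter> space (gen_alg P M K) \<in> sets (gen_alg P M K)"
    unfolding gen_alg_def using B assms by (auto simp: sets_measure_of)
qed simp

lemma sigma_finite_subalgebra_gen_alg: "sigma_finite_subalgebra P (gen_alg P M K)"
  using subalgebra_gen_alg
  by (intro finite_measure_subalgebra_is_sigma_finite)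
    (auto simp: finite_measure_subalgebra_def finite_measure_subalgebra_axioms_def finite_measure_axioms)

lemma gen_alg_empty: "gen_alg P M {} = sigma (space P) {}"
  by (simp add: gen_alg_def)

lemma integrable_M: "integrable P (M n)"
  by (rule square_integrable_imp_integrable[OF measurable_M square_integrable_M])

lemma cond_M:
  assumes "n \<ge> 1"
  shows "AE x in P. real_cond_exp P (gen_alg P M {..n - 1}) (M n) x = M (n - 1) x"
    and "AE x in P. real_cond_exp P (gen_alg P M {..n - 1}) (\<lambda>y. (M n y)\<^sup>2) x = (M (n - 1) x)\<^sup>2 + 1"
  using normal assms unfolding normal_martingale_def by blast+

lemma cond_exp_increment:
  "AE x in P. real_cond_exp P (gen_alg P M {..<n}) (increment M n) x = 0"
proof (cases n)
  case 0
  then show ?thesis using normal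
    by (simp add: increment_def[abs_def] normal_martingale_def gen_alg_empty)
next
  case (Suc m)
  interpret F: sigma_finite_subalgebra P "gen_alg P M {..<n}"
    by (rule sigma_finite_subalgebra_gen_alg)
  have eq: "{..m} = {..<n}" using Suc by auto
  have 1: "AE x in P. real_cond_exp P (gen_alg P M {..<n}) (M n) x = M m x"
    using cond_M(1)[of n] Suc eq by simp
  have 2: "AE x in P. real_cond_exp P (gen_alg P M {..<n}) (M m) x = M m x"
    by (rule F.real_cond_exp_F_meas[OF integrable_M measurable_gen_alg]) (simp add: Suc)
  show ?thesis
    using 1 2 F.real_cond_exp_diff[OF integrable_M[of n] integrable_M[of m]]
    by eventually_elim (simp add: increment_def[abs_def] Suc)
qed

text \<open>For positive \<open>n\<close>, expand \<open>(M\<^sub>n - M\<^sub>n\<^sub>-\<^sub>1)\<^sup>2\<close>. The factor \<open>M\<^sub>n\<^sub>-\<^sub>1\<close> belongs to the past and comes out of the cross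
  term, whose conditional expectation is \<open>M\<^sub>n\<^sub>-\<^sub>1\<^sup>2\<close> by the martingale property; the three terms leave 1.\<close>

lemma cond_exp_increment_square:
  "AE x in P. real_cond_exp P (gen_alg P M {..<n}) (\<lambda>y. (increment M n y)\<^sup>2) x = 1"
proof (cases n)
  case 0
  then show ?thesis using normal
    by (simp add: increment_def[abs_def] normal_martingale_def gen_alg_empty)
next
  case (Suc m)
  let ?F = "gen_alg P M {..<n}"
  interpret F: sigma_finite_subalgebra P ?F
    by (rule sigma_finite_subalgebra_gen_alg)
  have eq: "{..m} = {..<n}" using Suc by auto
  have Mm [measurable]: "M m \<in> borel_measurable ?F"
    by (rule measurable_gen_alg) (simp add: Suc)
  have int: "integrable P (\<lambda>x. M m x * M n x)"
    using square_integrable_M by (intro integrable_mult_of_square_integrable) auto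
  have 1: "AE x in P. real_cond_exp P ?F (M n) x = M m x"
    using cond_M(1)[of n] Suc eq by simp
  have 2: "AE x in P. real_cond_exp P ?F (\<lambda>x. (M n x)\<^sup>2) x = (M m x)\<^sup>2 + 1"
    using cond_M(2)[of n] Suc eq by simp
  have 3: "AE x in P. real_cond_exp P ?F (\<lambda>x. (M m x)\<^sup>2) x = (M m x)\<^sup>2"
    by (rule F.real_cond_exp_F_meas[OF square_integrable_M]) measurable
  have 4: "AE x in P. real_cond_exp P ?F (\<lambda>x. M m x * M n x) x = M m x * real_cond_exp P ?F (M n) x"
    by (rule F.real_cond_exp_mult[OF Mm measurable_M int])
  have 5: "AE x in P. real_cond_exp P ?F (\<lambda>x. 2 * (M m x * M n x)) x
      = 2 * real_cond_exp P ?F (\<lambda>x. M m x * M n x) x"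
    by (rule F.real_cond_exp_cmult[OF int])
  have 6: "AE x in P. real_cond_exp P ?F (\<lambda>x. (M n x)\<^sup>2 + (M m x)\<^sup>2) x
      = real_cond_exp P ?F (\<lambda>x. (M n x)\<^sup>2) x + real_cond_exp P ?F (\<lambda>x. (M m x)\<^sup>2) x"
    by (rule F.real_cond_exp_add[OF square_integrable_M square_integrable_M])
  have 7: "AE x in P. real_cond_exp P ?F (\<lambda>x. ((M n x)\<^sup>2 + (M m x)\<^sup>2) - 2 * (M m x * M n x)) x
      = real_cond_exp P ?F (\<lambda>x. (M n x)\<^sup>2 + (M m x)\<^sup>2) x - real_cond_exp P ?F (\<lambda>x. 2 * (M m x * M n x)) x"
    using square_integrable_M int by (intro F.real_cond_exp_diff) auto
  have sq: "(\<lambda>x. (increment M n x)\<^sup>2) = (\<lambda>x. ((M n x)\<^sup>2 + (M m x)\<^sup>2) - 2 * (M m x * M n x))"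
    by (auto simp: increment_def Suc power2_diff)
  show ?thesis
    unfolding sq using 1 2 3 4 5 6 7
    by eventually_elim (simp add: power2_eq_square)
qed

abbreviation real_Z :: "nat set \<Rightarrow> 'a \<Rightarrow> real" where
  "real_Z \<sigma> x \<equiv> (\<Prod>i\<in>\<sigma>. increment M i x)"

text \<open>The increment at a positive \<open>i\<close> involves \<open>M\<close> at \<open>i\<close> and at \<open>i - 1\<close>, so the index set that generates the
  \<open>\<sigma>\<close>-algebra has to be closed under predecessors. Initial segments and the set of all indices
  are.\<close>

lemma measurable_real_Z:
  assumes "\<sigma> \<subseteq> K" and down: "\<And>i. Suc i \<in> K \<Longrightarrow> i \<in> K"
  shows "real_Z \<sigma> \<in> borel_measurable (gen_alg P M K)"
proof (rule borel_measurable_prod)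
  fix i assume "i \<in> \<sigma>"
  then have i: "i \<in> K" using assms by auto
  show "increment M i \<in> borel_measurable (gen_alg P M K)"
  proof (cases i)
    case 0
    then show ?thesis using measurable_gen_alg[OF i] by (simp add: increment_def[abs_def])
  next
    case (Suc j)
    then have "j \<in> K" using i down by auto
    then show ?thesis using measurable_gen_alg[OF i] measurable_gen_alg[of j K] Suc
      by (auto simp: increment_def[abs_def])
  qed
qed

text \<open>The form of \<open>cond_exp_increment_square\<close> for the extended nonnegative integral. It can be tested against
  nonnegative functions without knowing that the product is integrable, which is
  the point at issue in \<open>square_integrable_mult_increment\<close>.\<close>

lemma nn_cond_exp_increment_square:
  "AE x in P. nn_cond_exp P (gen_alg P M {..<n}) (\<lambda>y. ennreal ((increment M n y)\<^sup>2)) x = 1"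
proof -
  let ?F = "gen_alg P M {..<n}"
  interpret F: sigma_finite_subalgebra P ?F
    by (rule sigma_finite_subalgebra_gen_alg)
  have "AE x in P. 0 = nn_cond_exp P ?F (\<lambda>y. 0) x"
    by (rule F.nn_cond_exp_F_meas) simp
  then show ?thesis
    using cond_exp_increment_square[of n]
  proof eventually_elim
    case (elim x)
    have "(\<lambda>y. ennreal (- (increment M n y)\<^sup>2)) = (\<lambda>y. 0)"
      by (auto simp: ennreal_neg)
    with elim have "enn2real (nn_cond_exp P ?F (\<lambda>y. ennreal ((increment M n y)\<^sup>2)) x) = 1"
      by (simp add: real_cond_exp_def)
    then show ?case
      \<comment> \<open>The value \<open>\<infinity>\<close> is excluded because the conversion to a real number sends it to 0.\<close>
      by (metis enn2real_top ennreal_1 ennreal_enn2real_if zero_neq_one)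
  qed
qed

lemma square_integrable_mult_increment:
  assumes f: "f \<in> borel_measurable (gen_alg P M {..<n})" and int: "integrable P (\<lambda>x. (f x)\<^sup>2)"
  shows "integrable P (\<lambda>x. (f x * increment M n x)\<^sup>2)"
proof -
  let ?F = "gen_alg P M {..<n}"
  interpret F: sigma_finite_subalgebra P ?F
    by (rule sigma_finite_subalgebra_gen_alg)
  note [measurable] = f measurable_from_subalg[OF subalgebra_gen_alg f]
  have "(\<integral>\<^sup>+ x. ennreal ((f x * increment M n x)\<^sup>2) \<partial>P)
      = (\<integral>\<^sup>+ x. ennreal ((f x)\<^sup>2) * ennreal ((increment M n x)\<^sup>2) \<partial>P)"
    by (simp add: power_mult_distrib ennreal_mult')
  also have "\<dots> = (\<integral>\<^sup>+ x. ennreal ((f x)\<^sup>2) * nn_cond_exp P ?F (\<lambda>y. ennreal ((increment M n y)\<^sup>2)) x \<partial>P)"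
    by (rule F.nn_cond_exp_intg[symmetric]) measurable
  also have "\<dots> = (\<integral>\<^sup>+ x. ennreal ((f x)\<^sup>2) \<partial>P)"
    by (rule nn_integral_cong_AE) (use nn_cond_exp_increment_square[of n] in eventually_elim, simp)
  also have "\<dots> < \<infinity>"
    using int by (simp add: nn_integral_eq_integral)
  finally show ?thesis
    by (intro integrableI_bounded) auto
qed

lemma real_Z_insert:
  assumes "finite \<sigma>" "n \<notin> \<sigma>"
  shows "real_Z (insert n \<sigma>) x = real_Z \<sigma> x * increment M n x"
  using assms by (simp add: mult.commute)

lemma square_integrable_real_Z:
  assumes "finite \<sigma>"
  shows "integrable P (\<lambda>x. (real_Z \<sigma> x)\<^sup>2)"
  using assms
proof (induction rule: finite_linorder_max_induct)
  case empty
  then show ?case by simp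
next
  case (insert n \<sigma>)
  have "real_Z \<sigma> \<in> borel_measurable (gen_alg P M {..<n})"
    using insert by (intro measurable_real_Z) auto
  from square_integrable_mult_increment[OF this insert.IH]
  show ?case using insert by (subst real_Z_insert) auto
qed

lemma measurable_real_Z_P [measurable]: "real_Z \<sigma> \<in> borel_measurable P"
  by measurable

lemma integrable_real_Z_mult:
  assumes "finite \<sigma>" "finite \<tau>"
  shows "integrable P (\<lambda>x. real_Z \<sigma> x * real_Z \<tau> x)"
  by (rule integrable_mult_of_square_integrable)
    (use assms in \<open>auto intro: measurable_real_Z_P square_integrable_real_Z\<close>)

text \<open>Condition on the past of the largest index \<open>n\<close>. If \<open>n\<close> lies in just one of the two sets, the
  increment at \<open>n\<close> occurs once and the expectation vanishes; if it lies in both, its square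
  integrates out to 1 and \<open>n\<close> can be removed from both sets.\<close>

lemma real_Z_orthonormal_below:
  assumes "\<sigma> \<subseteq> {..<n}" "\<tau> \<subseteq> {..<n}"
  shows "(LINT x|P. real_Z \<sigma> x * real_Z \<tau> x) = (if \<sigma> = \<tau> then 1 else 0)"
  using assms
proof (induction n arbitrary: \<sigma> \<tau>)
  case 0
  then show ?case by (simp add: prob_space)
next
  case (Suc n)
  let ?F = "gen_alg P M {..<n}"
  interpret F: sigma_finite_subalgebra P ?F
    by (rule sigma_finite_subalgebra_gen_alg)
  have fin: "finite \<sigma>" "finite \<tau>"
    using Suc.prems finite_subset finite_lessThan by blast+
  have meas: "real_Z \<rho> \<in> borel_measurable ?F" if "\<rho> \<subseteq> {..<n}" for \<rho>
    using that by (intro measurable_real_Z) auto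
  have below: "\<rho> - {n} \<subseteq> {..<n}" if "\<rho> \<subseteq> {..<Suc n}" for \<rho>
    using that by (auto simp: less_Suc_eq)
  have split: "real_Z \<rho> x = real_Z (\<rho> - {n}) x * increment M n x" if "n \<in> \<rho>" "finite \<rho>" for \<rho> x
    using that by (simp add: prod.remove mult.commute)
  have one: "(LINT x|P. real_Z \<rho> x * real_Z \<rho>' x) = 0"
    if r: "\<rho> \<subseteq> {..<n}" "\<rho>' \<subseteq> {..<Suc n}" "n \<in> \<rho>'" for \<rho> \<rho>'
  proof -
    have fin': "finite \<rho>" "finite \<rho>'"
      using r finite_subset finite_lessThan by blast+
    have eq: "real_Z \<rho> x * real_Z \<rho>' x = (real_Z \<rho> x * real_Z (\<rho>' - {n}) x) * increment M n x" for x
      using split[OF r(3) fin'(2)] by simp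
    have "(LINT x|P. real_Z \<rho> x * real_Z \<rho>' x)
        = (LINT x|P. (real_Z \<rho> x * real_Z (\<rho>' - {n}) x)
            * real_cond_exp P ?F (increment M n) x)"
      unfolding eq
      using integrable_real_Z_mult[OF fin', unfolded eq] meas[OF r(1)] meas[OF below[OF r(2)]]
      by (intro F.real_cond_exp_intg(2)[symmetric]) auto
    also have "\<dots> = (LINT x|P. 0)"
    proof (rule integral_cong_AE)
      show "AE x in P. (real_Z \<rho> x * real_Z (\<rho>' - {n}) x) * real_cond_exp P ?F (increment M n) x = 0"
        using cond_exp_increment[of n] by eventually_elim simp
    qed (auto intro!: borel_measurable_times measurable_real_Z_P borel_measurable_cond_exp2)
    finally show ?thesis by simp
  qed
  consider "n \<notin> \<sigma>" "n \<notin> \<tau>" | "n \<notin> \<sigma>" "n \<in> \<tau>" | "n \<in> \<sigma>" "n \<notin> \<tau>" | "n \<in> \<sigma>" "n \<in> \<tau>" by blast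
  then show ?case
  proof cases
    case 1
    then show ?thesis using Suc.IH[of \<sigma> \<tau>] below[OF Suc.prems(1)] below[OF Suc.prems(2)] by simp
  next
    case 2
    then show ?thesis using one[of \<sigma> \<tau>] below[OF Suc.prems(1)] Suc.prems by auto
  next
    case 3
    then show ?thesis using one[of \<tau> \<sigma>] below[OF Suc.prems(2)] Suc.prems
      by (auto simp: mult.commute)
  next
    case 4
    have eq: "real_Z \<sigma> x * real_Z \<tau> x
        = (real_Z (\<sigma> - {n}) x * real_Z (\<tau> - {n}) x) * (increment M n x)\<^sup>2" for x
      using split[OF 4(1) fin(1)] split[OF 4(2) fin(2)] by (simp add: power2_eq_square)
    have "(LINT x|P. real_Z \<sigma> x * real_Z \<tau> x)
        = (LINT x|P. (real_Z (\<sigma> - {n}) x * real_Z (\<tau> - {n}) x)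
            * real_cond_exp P ?F (\<lambda>y. (increment M n y)\<^sup>2) x)"
      unfolding eq
      using integrable_real_Z_mult[OF fin, unfolded eq]
        meas[OF below[OF Suc.prems(1)]] meas[OF below[OF Suc.prems(2)]]
      by (intro F.real_cond_exp_intg(2)[symmetric]) auto
    also have "\<dots> = (LINT x|P. real_Z (\<sigma> - {n}) x * real_Z (\<tau> - {n}) x)"
    proof (rule integral_cong_AE)
      show "AE x in P. (real_Z (\<sigma> - {n}) x * real_Z (\<tau> - {n}) x)
            * real_cond_exp P ?F (\<lambda>y. (increment M n y)\<^sup>2) x = real_Z (\<sigma> - {n}) x * real_Z (\<tau> - {n}) x"
        using cond_exp_increment_square[of n] by eventually_elim simp
    qed (auto intro!: borel_measurable_times measurable_real_Z_P borel_measurable_cond_exp2)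
    also have "\<dots> = (if \<sigma> - {n} = \<tau> - {n} then 1 else 0)"
      by (intro Suc.IH below Suc.prems)
    also have "\<dots> = (if \<sigma> = \<tau> then 1 else 0)" using 4 by auto
    finally show ?thesis .
  qed
qed

lemma Z_prod_orthonormal:
  assumes "finite \<sigma>" "finite \<tau>"
  shows "L2_inner P (Z_prod M \<sigma>) (Z_prod M \<tau>) = (if \<sigma> = \<tau> then 1 else 0)"
proof -
  obtain n where "\<sigma> \<union> \<tau> \<subseteq> {..<n}"
    using assms finite_nat_iff_bounded[of "\<sigma> \<union> \<tau>"] by auto
  then have r: "(LINT x|P. real_Z \<sigma> x * real_Z \<tau> x) = (if \<sigma> = \<tau> then 1 else 0)"
    by (intro real_Z_orthonormal_below[of _ n]) auto
  have "L2_inner P (Z_prod M \<sigma>) (Z_prod M \<tau>)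
      = (LINT x|P. complex_of_real (real_Z \<sigma> x * real_Z \<tau> x))"
    by (simp add: L2_inner_def Z_prod_def)
  also have "\<dots> = complex_of_real (LINT x|P. real_Z \<sigma> x * real_Z \<tau> x)"
    by (rule integral_complex_of_real)
  finally show ?thesis using r by simp
qed

section \<open>The test functionals\<close>

abbreviation coeff :: "nat set \<Rightarrow> ('a \<Rightarrow> complex) \<Rightarrow> complex" where
  "coeff \<sigma> \<xi> \<equiv> L2_inner P (Z_prod M \<sigma>) \<xi>"

lemma L2M_imp_L2_space:
  assumes "\<xi> \<in> L2M P M"
  shows "\<xi> \<in> L2_space P"
proof -
  have sub: "subalgebra P (gen_alg P M UNIV)" by (rule subalgebra_gen_alg)
  have "\<xi> \<in> borel_measurable (gen_alg P M UNIV)"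
    using assms by (auto simp: L2M_def L2_space_def intro: measurable_in_subalg'[OF sub])
  then have "\<xi> \<in> borel_measurable P" by (rule measurable_from_subalg[OF sub])
  then show ?thesis
    using assms by (auto simp: L2M_def L2_space_def intro: integrable_from_subalg[OF sub])
qed

lemma Z_prod_in_L2M:
  assumes "finite \<sigma>"
  shows "Z_prod M \<sigma> \<in> L2M P M"
proof -
  have sub: "subalgebra P (gen_alg P M UNIV)" by (rule subalgebra_gen_alg)
  have meas: "real_Z \<sigma> \<in> borel_measurable (gen_alg P M UNIV)"
    by (rule measurable_real_Z) auto
  have "(\<lambda>x. (real_Z \<sigma> x)\<^sup>2) \<in> borel_measurable (gen_alg P M UNIV)"
    using meas by (rule borel_measurable_power)
  from integrable_in_subalg[OF sub this square_integrable_real_Z[OF assms]]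
  have "integrable (restr_to_subalg P (gen_alg P M UNIV)) (\<lambda>x. (real_Z \<sigma> x)\<^sup>2)" .
  moreover have "(\<lambda>x. complex_of_real (real_Z \<sigma> x)) \<in> borel_measurable (restr_to_subalg P (gen_alg P M UNIV))"
    by (rule measurable_compose[OF measurable_in_subalg[OF sub meas] borel_measurable_of_real])
  ultimately show ?thesis
    by (simp add: L2M_def L2_space_def Z_prod_def[abs_def] del: of_real_prod)
qed

lemma coeff_add:
  assumes "finite \<sigma>" "\<xi> \<in> L2M P M" "\<eta> \<in> L2M P M"
  shows "coeff \<sigma> (\<lambda>x. \<xi> x + \<eta> x) = coeff \<sigma> \<xi> + coeff \<sigma> \<eta>"
  using assms by (intro L2_inner_add L2M_imp_L2_space Z_prod_in_L2M)

lemma coeff_diff: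
  assumes "finite \<sigma>" "\<xi> \<in> L2M P M" "\<eta> \<in> L2M P M"
  shows "coeff \<sigma> (\<lambda>x. \<xi> x - \<eta> x) = coeff \<sigma> \<xi> - coeff \<sigma> \<eta>"
proof -
  have "(\<lambda>x. -1 * \<eta> x) \<in> L2M P M"
    using assms(3) unfolding L2M_def by (rule L2_space_cmult)
  from coeff_add[OF assms(1,2) this] show ?thesis
    unfolding L2_inner_cmult by simp
qed

lemma S_space_imp_L2M: "\<xi> \<in> S_space P M \<Longrightarrow> \<xi> \<in> L2M P M"
  by (auto simp: S_space_def Sp_space_def)

text \<open>The space of test functionals is an intersection over natural exponents only. As the
  weights are at least 1, this covers all real exponents.\<close>

lemma S_space_summable:
  assumes "\<xi> \<in> S_space P M"
  shows "(\<lambda>\<sigma>. weight \<sigma> powr (2 * p) * (cmod (coeff \<sigma> \<xi>))\<^sup>2) summable_on fin_subsets"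
proof -
  obtain q :: nat where q: "p \<le> real q" using real_arch_simple by blast
  show ?thesis
  proof (rule summable_on_comparison_test)
    show "(\<lambda>\<sigma>. weight \<sigma> powr (2 * real q) * (cmod (coeff \<sigma> \<xi>))\<^sup>2) summable_on fin_subsets"
      using assms by (auto simp: S_space_def Sp_space_def)
    show "weight \<sigma> powr (2 * p) * (cmod (coeff \<sigma> \<xi>))\<^sup>2
        \<le> weight \<sigma> powr (2 * real q) * (cmod (coeff \<sigma> \<xi>))\<^sup>2" for \<sigma>
      using q weight_ge_1[of \<sigma>] by (intro mult_right_mono powr_mono) auto
  qed simp
qed

lemma S_space_add:
  assumes \<xi>: "\<xi> \<in> S_space P M" and \<eta>: "\<eta> \<in> S_space P M"
  shows "(\<lambda>x. \<xi> x + \<eta> x) \<in> S_space P M"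
proof -
  have L: "(\<lambda>x. \<xi> x + \<eta> x) \<in> L2M P M"
    using S_space_imp_L2M[OF \<xi>] S_space_imp_L2M[OF \<eta>] unfolding L2M_def by (rule L2_space_add)
  have "(\<lambda>\<sigma>. weight \<sigma> powr (2 * p) * (cmod (coeff \<sigma> (\<lambda>x. \<xi> x + \<eta> x)))\<^sup>2) summable_on fin_subsets" for p
  proof (rule summable_on_comparison_test)
    show "(\<lambda>\<sigma>. 2 * (weight \<sigma> powr (2 * p) * (cmod (coeff \<sigma> \<xi>))\<^sup>2)
        + 2 * (weight \<sigma> powr (2 * p) * (cmod (coeff \<sigma> \<eta>))\<^sup>2)) summable_on fin_subsets"
      by (intro summable_on_add summable_on_cmult_right S_space_summable \<xi> \<eta>)
    fix \<sigma> assume "\<sigma> \<in> fin_subsets"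
    then have "coeff \<sigma> (\<lambda>x. \<xi> x + \<eta> x) = coeff \<sigma> \<xi> + coeff \<sigma> \<eta>"
      using \<xi> \<eta> by (intro coeff_add S_space_imp_L2M) (auto simp: fin_subsets_def)
    then have "(cmod (coeff \<sigma> (\<lambda>x. \<xi> x + \<eta> x)))\<^sup>2 \<le> (cmod (coeff \<sigma> \<xi>) + cmod (coeff \<sigma> \<eta>))\<^sup>2"
      by (simp add: norm_triangle_ineq power_mono)
    also have "\<dots> \<le> 2 * (cmod (coeff \<sigma> \<xi>))\<^sup>2 + 2 * (cmod (coeff \<sigma> \<eta>))\<^sup>2"
      using sum_squares_bound[of "cmod (coeff \<sigma> \<xi>)" "cmod (coeff \<sigma> \<eta>)"] by (simp add: power2_sum)
    finally have "weight \<sigma> powr (2 * p) * (cmod (coeff \<sigma> (\<lambda>x. \<xi> x + \<eta> x)))\<^sup>2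
        \<le> weight \<sigma> powr (2 * p) * (2 * (cmod (coeff \<sigma> \<xi>))\<^sup>2 + 2 * (cmod (coeff \<sigma> \<eta>))\<^sup>2)"
      by (intro mult_left_mono) auto
    then show "weight \<sigma> powr (2 * p) * (cmod (coeff \<sigma> (\<lambda>x. \<xi> x + \<eta> x)))\<^sup>2
        \<le> 2 * (weight \<sigma> powr (2 * p) * (cmod (coeff \<sigma> \<xi>))\<^sup>2)
          + 2 * (weight \<sigma> powr (2 * p) * (cmod (coeff \<sigma> \<eta>))\<^sup>2)"
      by (simp add: algebra_simps)
  qed simp
  with L show ?thesis by (simp add: S_space_def Sp_space_def)
qed

lemma S_space_cmult:
  assumes "\<xi> \<in> S_space P M"
  shows "(\<lambda>x. c * \<xi> x) \<in> S_space P M"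
proof -
  have "(\<lambda>x. c * \<xi> x) \<in> L2M P M"
    using S_space_imp_L2M[OF assms] unfolding L2M_def by (rule L2_space_cmult)
  moreover have "(\<lambda>\<sigma>. weight \<sigma> powr (2 * p) * (cmod (coeff \<sigma> (\<lambda>x. c * \<xi> x)))\<^sup>2) summable_on fin_subsets" for p
    using summable_on_cmult_right[OF S_space_summable[OF assms, of p], of "(cmod c)\<^sup>2"]
    by (simp add: L2_inner_cmult norm_mult power_mult_distrib ac_simps)
  ultimately show ?thesis by (simp add: S_space_def Sp_space_def)
qed

lemma S_space_diff:
  assumes "\<xi> \<in> S_space P M" "\<eta> \<in> S_space P M"
  shows "(\<lambda>x. \<xi> x - \<eta> x) \<in> S_space P M"
  using S_space_add[OF assms(1) S_space_cmult[OF assms(2), of "-1"]] by simp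

lemma Z_prod_in_S_space:
  assumes "finite \<sigma>"
  shows "Z_prod M \<sigma> \<in> S_space P M"
proof -
  have "(\<lambda>\<tau>. weight \<tau> powr (2 * p) * (cmod (coeff \<tau> (Z_prod M \<sigma>)))\<^sup>2) summable_on fin_subsets" for p
  proof (rule has_sum_imp_summable, rule has_sum_finite_neutralI)
    show "weight \<tau> powr (2 * p) * (cmod (coeff \<tau> (Z_prod M \<sigma>)))\<^sup>2 = 0" if "\<tau> \<in> fin_subsets - {\<sigma>}" for \<tau>
      using that assms by (auto simp: fin_subsets_def Z_prod_orthonormal)
  qed (use assms in \<open>auto simp: fin_subsets_def\<close>)
  with Z_prod_in_L2M[OF assms] show ?thesis by (simp add: S_space_def Sp_space_def)
qed

section \<open>Chaos expansions\<close>

abbreviation chaos_poly :: "(nat set \<Rightarrow> complex) \<Rightarrow> nat set set \<Rightarrow> 'a \<Rightarrow> complex" where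
  "chaos_poly c A \<equiv> \<lambda>x. \<Sum>\<sigma>\<in>A. c \<sigma> * Z_prod M \<sigma> x"

lemma chaos_poly_in_S_space:
  assumes "finite A" "A \<subseteq> fin_subsets"
  shows "chaos_poly c A \<in> S_space P M"
  using assms
proof (induction A rule: finite_induct)
  case empty
  show ?case using S_space_cmult[OF Z_prod_in_S_space[of "{}"], of 0] by simp
next
  case (insert \<sigma> A)
  then show ?case
    using S_space_add[OF S_space_cmult[OF Z_prod_in_S_space[of \<sigma>], of "c \<sigma>"], of "chaos_poly c A"]
    by (simp add: fin_subsets_def)
qed

lemma coeff_chaos_poly:
  assumes "finite A" "A \<subseteq> fin_subsets" "finite \<tau>"
  shows "coeff \<tau> (chaos_poly c A) = (if \<tau> \<in> A then c \<tau> else 0)"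
  using assms
proof (induction A rule: finite_induct)
  case empty
  show ?case by (simp add: L2_inner_def)
next
  case (insert \<sigma> A)
  have \<sigma>: "finite \<sigma>" using insert by (simp add: fin_subsets_def)
  have "coeff \<tau> (chaos_poly c (insert \<sigma> A)) = coeff \<tau> (\<lambda>x. c \<sigma> * Z_prod M \<sigma> x + chaos_poly c A x)"
    using insert by simp
  also have "\<dots> = coeff \<tau> (\<lambda>x. c \<sigma> * Z_prod M \<sigma> x) + coeff \<tau> (chaos_poly c A)"
    using insert \<sigma>
    by (intro coeff_add S_space_imp_L2M S_space_cmult Z_prod_in_S_space chaos_poly_in_S_space) auto
  also have "\<dots> = c \<sigma> * (if \<tau> = \<sigma> then 1 else 0) + (if \<tau> \<in> A then c \<tau> else 0)"
    using insert \<sigma> by (simp add: L2_inner_cmult Z_prod_orthonormal)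
  finally show ?case using insert by auto
qed

text \<open>The subbasic open sets of the topology are balls around arbitrary centres \<open>\<zeta>\<close>, so it is the
  distance to \<open>\<zeta>\<close> whose convergence is needed. Truncating the expansion of \<open>\<xi>\<close> to \<open>A\<close> leaves the
  coefficients of \<open>\<xi> - \<zeta>\<close> on \<open>A\<close> and those of \<open>-\<zeta>\<close> outside. The squared distance is therefore
  a partial sum of the series for \<open>\<parallel>\<xi> - \<zeta>\<parallel>\<^sub>p\<^sup>2\<close> plus a tail of the series for \<open>\<parallel>\<zeta>\<parallel>\<^sub>p\<^sup>2\<close>. Working with
  general \<open>\<zeta>\<close> avoids the triangle inequality for the norms.\<close>

lemma tendsto_p_norm_chaos_poly_diff:
  assumes \<xi>: "\<xi> \<in> S_space P M" and \<zeta>: "\<zeta> \<in> S_space P M"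
  shows "((\<lambda>A. p_norm P M p (\<lambda>x. chaos_poly (\<lambda>\<sigma>. coeff \<sigma> \<xi>) A x - \<zeta> x))
    \<longlongrightarrow> p_norm P M p (\<lambda>x. \<xi> x - \<zeta> x)) (finite_subsets_at_top fin_subsets)"
proof -
  define u where "u \<sigma> = weight \<sigma> powr (2 * p) * (cmod (coeff \<sigma> (\<lambda>x. \<xi> x - \<zeta> x)))\<^sup>2" for \<sigma>
  define v where "v \<sigma> = weight \<sigma> powr (2 * p) * (cmod (coeff \<sigma> \<zeta>))\<^sup>2" for \<sigma>
  have u: "u summable_on fin_subsets"
    unfolding u_def by (intro S_space_summable S_space_diff \<xi> \<zeta>)
  have v: "v summable_on fin_subsets"
    unfolding v_def by (intro S_space_summable \<zeta>)
  have eq: "p_norm P M p (\<lambda>x. chaos_poly (\<lambda>\<sigma>. coeff \<sigma> \<xi>) A x - \<zeta> x)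
      = sqrt (sum u A + (infsum v fin_subsets - sum v A))"
    if A: "finite A" "A \<subseteq> fin_subsets" for A
  proof -
    let ?w = "\<lambda>\<sigma>. if \<sigma> \<in> A then u \<sigma> - v \<sigma> else 0"
    have "(?w has_sum (sum u A - sum v A)) fin_subsets"
      using A by (intro has_sum_finite_neutralI[of A]) (auto simp: sum_subtractf)
    from has_sum_add[OF this has_sum_infsum[OF v]]
    have "((\<lambda>\<sigma>. ?w \<sigma> + v \<sigma>) has_sum (sum u A - sum v A + infsum v fin_subsets)) fin_subsets" .
    moreover have "weight \<sigma> powr (2 * p)
          * (cmod (coeff \<sigma> (\<lambda>x. chaos_poly (\<lambda>\<sigma>. coeff \<sigma> \<xi>) A x - \<zeta> x)))\<^sup>2 = ?w \<sigma> + v \<sigma>"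
      if "\<sigma> \<in> fin_subsets" for \<sigma>
    proof -
      have \<sigma>: "finite \<sigma>" using that by (simp add: fin_subsets_def)
      have "coeff \<sigma> (\<lambda>x. chaos_poly (\<lambda>\<sigma>. coeff \<sigma> \<xi>) A x - \<zeta> x)
          = (if \<sigma> \<in> A then coeff \<sigma> \<xi> else 0) - coeff \<sigma> \<zeta>"
        using \<sigma> A by (simp add: coeff_diff coeff_chaos_poly S_space_imp_L2M chaos_poly_in_S_space \<zeta>)
      moreover have "coeff \<sigma> (\<lambda>x. \<xi> x - \<zeta> x) = coeff \<sigma> \<xi> - coeff \<sigma> \<zeta>"
        by (intro coeff_diff \<sigma> S_space_imp_L2M \<xi> \<zeta>)
      ultimately show ?thesis by (simp add: u_def v_def)
    qed
    ultimately have "((\<lambda>\<sigma>. weight \<sigma> powr (2 * p)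
          * (cmod (coeff \<sigma> (\<lambda>x. chaos_poly (\<lambda>\<sigma>. coeff \<sigma> \<xi>) A x - \<zeta> x)))\<^sup>2)
        has_sum (sum u A - sum v A + infsum v fin_subsets)) fin_subsets"
      by (subst has_sum_cong) auto
    then show ?thesis
      unfolding p_norm_def by (simp add: infsumI algebra_simps)
  qed
  have "((\<lambda>A. sqrt (sum u A + (infsum v fin_subsets - sum v A)))
      \<longlongrightarrow> sqrt (infsum u fin_subsets + (infsum v fin_subsets - infsum v fin_subsets)))
      (finite_subsets_at_top fin_subsets)"
    by (intro tendsto_intros infsum_tendsto u v)
  moreover have "sqrt (infsum u fin_subsets + (infsum v fin_subsets - infsum v fin_subsets))
      = p_norm P M p (\<lambda>x. \<xi> x - \<zeta> x)"
    by (simp add: p_norm_def flip: u_def)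
  moreover have "\<forall>\<^sub>F A in finite_subsets_at_top fin_subsets.
      sqrt (sum u A + (infsum v fin_subsets - sum v A))
        = p_norm P M p (\<lambda>x. chaos_poly (\<lambda>\<sigma>. coeff \<sigma> \<xi>) A x - \<zeta> x)"
    by (rule eventually_finite_subsets_at_top_weakI) (simp add: eq)
  ultimately show ?thesis by (simp add: tendsto_cong)
qed

text \<open>The sets that contain \<open>\<xi>\<close> only if they eventually contain the partial sums are closed under
  finite intersections and arbitrary unions, so it is enough to consider the balls that generate the
  topology.\<close>

lemma chaos_expansion_limitin:
  assumes \<xi>: "\<xi> \<in> S_space P M"
  shows "limitin (S_topology P M) (chaos_poly (\<lambda>\<sigma>. coeff \<sigma> \<xi>)) \<xi> (finite_subsets_at_top fin_subsets)"
  unfolding limitin_def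
proof (intro conjI allI impI)
  show "\<xi> \<in> topspace (S_topology P M)" by (simp add: topspace_S_topology \<xi>)
next
  fix U assume U: "openin (S_topology P M) U \<and> \<xi> \<in> U"
  then have "generate_topology_on {{\<eta> \<in> S_space P M. p_norm P M p (\<lambda>x. \<eta> x - \<zeta> x) < \<epsilon>} | \<zeta> p \<epsilon>.
        \<zeta> \<in> S_space P M \<and> 0 \<le> p \<and> 0 < \<epsilon>} U"
    unfolding S_topology_def by (intro openin_topology_generated_by) blast
  then show "\<forall>\<^sub>F A in finite_subsets_at_top fin_subsets. chaos_poly (\<lambda>\<sigma>. coeff \<sigma> \<xi>) A \<in> U"
    using U[THEN conjunct2]
  proof induction
    case Empty
    then show ?case by simp
  next
    case (Int a b)
    then show ?case by (auto intro: eventually_conj)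
  next
    case (UN K)
    then obtain k where k: "k \<in> K" "\<xi> \<in> k" by blast
    from UN.IH[OF this] show ?case by (rule eventually_mono) (use k in blast)
  next
    case (Basis s)
    then obtain \<zeta> p \<epsilon> where s: "s = {\<eta> \<in> S_space P M. p_norm P M p (\<lambda>x. \<eta> x - \<zeta> x) < \<epsilon>}"
      and \<zeta>: "\<zeta> \<in> S_space P M" by blast
    have "p_norm P M p (\<lambda>x. \<xi> x - \<zeta> x) < \<epsilon>" using Basis s by simp
    from order_tendstoD(2)[OF tendsto_p_norm_chaos_poly_diff[OF \<xi> \<zeta>] this]
    have "\<forall>\<^sub>F A in finite_subsets_at_top fin_subsets.
        p_norm P M p (\<lambda>x. chaos_poly (\<lambda>\<sigma>. coeff \<sigma> \<xi>) A x - \<zeta> x) < \<epsilon>" .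
    moreover have "\<forall>\<^sub>F A in finite_subsets_at_top fin_subsets.
        chaos_poly (\<lambda>\<sigma>. coeff \<sigma> \<xi>) A \<in> S_space P M"
      by (rule eventually_finite_subsets_at_top_weakI) (rule chaos_poly_in_S_space)
    ultimately show ?case unfolding s by eventually_elim simp
  qed
qed

lemma gen_functional_add:
  assumes "\<Psi> \<in> gen_functionals P M" "\<xi> \<in> S_space P M" "\<eta> \<in> S_space P M"
  shows "\<Psi> (\<lambda>x. \<xi> x + \<eta> x) = \<Psi> \<xi> + \<Psi> \<eta>"
  using assms by (simp add: gen_functionals_def)

lemma gen_functional_cmult:
  assumes "\<Psi> \<in> gen_functionals P M" "\<xi> \<in> S_space P M"
  shows "\<Psi> (\<lambda>x. c * \<xi> x) = c * \<Psi> \<xi>"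
  using assms by (simp add: gen_functionals_def)

lemma gen_functional_chaos_poly:
  assumes \<Psi>: "\<Psi> \<in> gen_functionals P M" and A: "finite A" "A \<subseteq> fin_subsets"
  shows "\<Psi> (chaos_poly c A) = (\<Sum>\<sigma>\<in>A. c \<sigma> * fock_transform M \<Psi> \<sigma>)"
  using A
proof (induction A rule: finite_induct)
  case empty
  \<comment> \<open>The empty sum is 0 times a test functional, so homogeneity gives the value 0.\<close>
  have "\<Psi> (\<lambda>x. 0 * Z_prod M {} x) = 0 * \<Psi> (Z_prod M {})"
    by (intro gen_functional_cmult \<Psi> Z_prod_in_S_space) simp
  then show ?case by simp
next
  case (insert \<sigma> A)
  then have \<sigma>: "finite \<sigma>" and A: "A \<subseteq> fin_subsets" by (auto simp: fin_subsets_def)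
  have "\<Psi> (\<lambda>x. c \<sigma> * Z_prod M \<sigma> x + chaos_poly c A x)
      = \<Psi> (\<lambda>x. c \<sigma> * Z_prod M \<sigma> x) + \<Psi> (chaos_poly c A)"
    by (rule gen_functional_add[OF \<Psi> S_space_cmult[OF Z_prod_in_S_space[OF \<sigma>]]
          chaos_poly_in_S_space[OF insert.hyps(1) A]])
  moreover have "\<Psi> (\<lambda>x. c \<sigma> * Z_prod M \<sigma> x) = c \<sigma> * \<Psi> (Z_prod M \<sigma>)"
    by (rule gen_functional_cmult[OF \<Psi> Z_prod_in_S_space[OF \<sigma>]])
  ultimately show ?case
    using insert.IH[OF A] insert.hyps by (simp add: fock_transform_def)
qed

text \<open>Continuity and linearity transport the convergence of the chaos expansion to the values of
  the functional. This is what makes the Fock transform injective.\<close>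

lemma gen_functional_has_sum:
  assumes \<Psi>: "\<Psi> \<in> gen_functionals P M" and \<xi>: "\<xi> \<in> S_space P M"
  shows "((\<lambda>\<sigma>. coeff \<sigma> \<xi> * fock_transform M \<Psi> \<sigma>) has_sum \<Psi> \<xi>) fin_subsets"
proof -
  have "continuous_map (S_topology P M) euclidean \<Psi>"
    using \<Psi> by (simp add: gen_functionals_def)
  from continuous_map_limit[OF this chaos_expansion_limitin[OF \<xi>]]
  have "((\<lambda>A. \<Psi> (chaos_poly (\<lambda>\<sigma>. coeff \<sigma> \<xi>) A)) \<longlongrightarrow> \<Psi> \<xi>) (finite_subsets_at_top fin_subsets)"
    by (simp add: o_def)
  moreover have "\<forall>\<^sub>F A in finite_subsets_at_top fin_subsets.
      \<Psi> (chaos_poly (\<lambda>\<sigma>. coeff \<sigma> \<xi>) A) = (\<Sum>\<sigma>\<in>A. coeff \<sigma> \<xi> * fock_transform M \<Psi> \<sigma>)"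
    by (rule eventually_finite_subsets_at_top_weakI) (rule gen_functional_chaos_poly[OF \<Psi>])
  ultimately show ?thesis
    unfolding has_sum_def by (simp add: tendsto_cong)
qed

lemma gen_functional_eqI:
  assumes \<Phi>: "\<Phi> \<in> gen_functionals P M" and \<Psi>: "\<Psi> \<in> gen_functionals P M"
    and eq: "\<And>\<sigma>. \<sigma> \<in> fin_subsets \<Longrightarrow> fock_transform M \<Phi> \<sigma> = fock_transform M \<Psi> \<sigma>"
  shows "\<Phi> = \<Psi>"
proof (rule extensionalityI)
  show "\<Phi> \<in> extensional (S_space P M)" "\<Psi> \<in> extensional (S_space P M)"
    using \<Phi> \<Psi> by (simp_all add: gen_functionals_def)
  fix \<xi> assume \<xi>: "\<xi> \<in> S_space P M"
  have "((\<lambda>\<sigma>. coeff \<sigma> \<xi> * fock_transform M \<Psi> \<sigma>) has_sum \<Phi> \<xi>) fin_subsets"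
    using gen_functional_has_sum[OF \<Phi> \<xi>] by (simp add: eq cong: has_sum_cong)
  then show "\<Phi> \<xi> = \<Psi> \<xi>"
    using gen_functional_has_sum[OF \<Psi> \<xi>] by (rule has_sum_unique)
qed

section \<open>The functional with a prescribed Fock transform\<close>

definition dual_pairing :: "(nat set \<Rightarrow> complex) \<Rightarrow> ('a \<Rightarrow> complex) \<Rightarrow> complex" where
  "dual_pairing F = (\<lambda>\<xi>\<in>S_space P M. \<Sum>\<^sub>\<infinity>\<sigma>\<in>fin_subsets. F \<sigma> * coeff \<sigma> \<xi>)"

context
  fixes F :: "nat set \<Rightarrow> complex" and C p :: real
  assumes C: "C \<ge> 0" and p: "p \<ge> 0"
    and growth: "\<forall>\<sigma>\<in>fin_subsets. cmod (F \<sigma>) \<le> C * weight \<sigma> powr p"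
begin

lemma sum_dual_pairing_le:
  assumes \<xi>: "\<xi> \<in> S_space P M" and A: "finite A" "A \<subseteq> fin_subsets"
  shows "(\<Sum>\<sigma>\<in>A. cmod (F \<sigma> * coeff \<sigma> \<xi>)) \<le> 2 * C * p_norm P M (p + 1) \<xi>"
proof -
  have "(\<Sum>\<sigma>\<in>A. cmod (F \<sigma> * coeff \<sigma> \<xi>))
      \<le> 2 * C * sqrt (\<Sum>\<sigma>\<in>A. weight \<sigma> powr (2 * (p + 1)) * (cmod (coeff \<sigma> \<xi>))\<^sup>2)"
    by (rule weighted_Cauchy_Schwarz[OF growth C A])
  also have "\<dots> \<le> 2 * C * p_norm P M (p + 1) \<xi>"
    unfolding p_norm_def using C A
    by (intro mult_left_mono real_sqrt_le_mono finite_sum_le_infsum S_space_summable[OF \<xi>]) auto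
  finally show ?thesis .
qed

lemma dual_pairing_abs_summable:
  assumes \<xi>: "\<xi> \<in> S_space P M"
  shows "(\<lambda>\<sigma>. cmod (F \<sigma> * coeff \<sigma> \<xi>)) summable_on fin_subsets"
proof (rule nonneg_bdd_above_summable_on)
  show "bdd_above (sum (\<lambda>\<sigma>. cmod (F \<sigma> * coeff \<sigma> \<xi>)) ` {A. A \<subseteq> fin_subsets \<and> finite A})"
    using sum_dual_pairing_le[OF \<xi>] by (intro bdd_aboveI2) auto
qed simp

lemma norm_dual_pairing_le:
  assumes \<xi>: "\<xi> \<in> S_space P M"
  shows "cmod (dual_pairing F \<xi>) \<le> 2 * C * p_norm P M (p + 1) \<xi>"
proof -
  have "cmod (dual_pairing F \<xi>) \<le> (\<Sum>\<^sub>\<infinity>\<sigma>\<in>fin_subsets. cmod (F \<sigma> * coeff \<sigma> \<xi>))"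
    using norm_infsum_bound[OF dual_pairing_abs_summable[OF \<xi>]] \<xi> by (simp add: dual_pairing_def)
  also have "\<dots> \<le> 2 * C * p_norm P M (p + 1) \<xi>"
    using dual_pairing_abs_summable[OF \<xi>]
    by (rule infsum_le_finite_sums) (rule sum_dual_pairing_le[OF \<xi>])
  finally show ?thesis .
qed

lemma dual_pairing_add:
  assumes \<xi>: "\<xi> \<in> S_space P M" and \<eta>: "\<eta> \<in> S_space P M"
  shows "dual_pairing F (\<lambda>x. \<xi> x + \<eta> x) = dual_pairing F \<xi> + dual_pairing F \<eta>"
proof -
  have "(\<Sum>\<^sub>\<infinity>\<sigma>\<in>fin_subsets. F \<sigma> * coeff \<sigma> (\<lambda>x. \<xi> x + \<eta> x))
      = (\<Sum>\<^sub>\<infinity>\<sigma>\<in>fin_subsets. F \<sigma> * coeff \<sigma> \<xi> + F \<sigma> * coeff \<sigma> \<eta>)"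
  proof (rule infsum_cong)
    fix \<sigma> assume "\<sigma> \<in> fin_subsets"
    then have "coeff \<sigma> (\<lambda>x. \<xi> x + \<eta> x) = coeff \<sigma> \<xi> + coeff \<sigma> \<eta>"
      by (intro coeff_add S_space_imp_L2M \<xi> \<eta>) (simp add: fin_subsets_def)
    then show "F \<sigma> * coeff \<sigma> (\<lambda>x. \<xi> x + \<eta> x) = F \<sigma> * coeff \<sigma> \<xi> + F \<sigma> * coeff \<sigma> \<eta>"
      by (simp add: distrib_left)
  qed
  also have "\<dots> = (\<Sum>\<^sub>\<infinity>\<sigma>\<in>fin_subsets. F \<sigma> * coeff \<sigma> \<xi>) + (\<Sum>\<^sub>\<infinity>\<sigma>\<in>fin_subsets. F \<sigma> * coeff \<sigma> \<eta>)"
    by (intro infsum_add abs_summable_summable[OF dual_pairing_abs_summable] \<xi> \<eta>)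
  finally show ?thesis
    using \<xi> \<eta> S_space_add[OF \<xi> \<eta>] by (simp add: dual_pairing_def)
qed

lemma dual_pairing_cmult:
  assumes \<xi>: "\<xi> \<in> S_space P M"
  shows "dual_pairing F (\<lambda>x. c * \<xi> x) = c * dual_pairing F \<xi>"
proof -
  have "(\<Sum>\<^sub>\<infinity>\<sigma>\<in>fin_subsets. F \<sigma> * coeff \<sigma> (\<lambda>x. c * \<xi> x))
      = (\<Sum>\<^sub>\<infinity>\<sigma>\<in>fin_subsets. c * (F \<sigma> * coeff \<sigma> \<xi>))"
    by (simp add: L2_inner_cmult ac_simps)
  then show ?thesis
    using \<xi> S_space_cmult[OF \<xi>] by (simp add: dual_pairing_def infsum_cmult_right')
qed

text \<open>By linearity the bound by the single norm of exponent \<open>p + 1\<close> makes the pairing Lipschitz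
  for that norm, and the balls of that norm are open.\<close>

lemma continuous_map_dual_pairing: "continuous_map (S_topology P M) euclidean (dual_pairing F)"
  unfolding continuous_map_def
proof (intro conjI allI impI)
  show "dual_pairing F \<in> topspace (S_topology P M) \<rightarrow> topspace euclidean" by simp
next
  fix U :: "complex set" assume "openin euclidean U"
  then have U: "open U" by simp
  show "openin (S_topology P M) {\<xi> \<in> topspace (S_topology P M). dual_pairing F \<xi> \<in> U}"
    unfolding topspace_S_topology
  proof (subst openin_subopen, intro ballI)
    fix \<xi> assume "\<xi> \<in> {\<xi> \<in> S_space P M. dual_pairing F \<xi> \<in> U}"
    then have \<xi>: "\<xi> \<in> S_space P M" and "dual_pairing F \<xi> \<in> U" by auto
    then obtain e where e: "e > 0" "\<And>z. dist z (dual_pairing F \<xi>) < e \<Longrightarrow> z \<in> U"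
      using U unfolding open_dist by blast
    \<comment> \<open>The Lipschitz constant is \<open>2 * C\<close>; adding 1 keeps the denominator positive when \<open>C\<close> is 0.\<close>
    define \<epsilon> where "\<epsilon> = e / (2 * C + 1)"
    have \<epsilon>: "\<epsilon> > 0" using e C by (simp add: \<epsilon>_def)
    define T where "T = {\<eta> \<in> S_space P M. p_norm P M (p + 1) (\<lambda>x. \<eta> x - \<xi> x) < \<epsilon>}"
    have "openin (S_topology P M) T"
      unfolding S_topology_def T_def
      by (rule topology_generated_by_Basis, rule CollectI,
          rule exI[of _ \<xi>], rule exI[of _ "p + 1"], rule exI[of _ \<epsilon>]) (use \<xi> \<epsilon> p in simp)
    moreover have "\<xi> \<in> T"
      using \<xi> \<epsilon> by (simp add: T_def p_norm_def L2_inner_def)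
    moreover have "dual_pairing F \<eta> \<in> U" if "\<eta> \<in> T" for \<eta>
    proof (rule e(2))
      have \<eta>: "\<eta> \<in> S_space P M" and close: "p_norm P M (p + 1) (\<lambda>x. \<eta> x - \<xi> x) < \<epsilon>"
        using that by (auto simp: T_def)
      have "dual_pairing F \<eta> = dual_pairing F \<xi> + dual_pairing F (\<lambda>x. \<eta> x - \<xi> x)"
        using dual_pairing_add[OF \<xi> S_space_diff[OF \<eta> \<xi>]] by simp
      then have "dist (dual_pairing F \<eta>) (dual_pairing F \<xi>) = cmod (dual_pairing F (\<lambda>x. \<eta> x - \<xi> x))"
        by (simp add: dist_norm)
      also have "\<dots> \<le> 2 * C * p_norm P M (p + 1) (\<lambda>x. \<eta> x - \<xi> x)"
        by (rule norm_dual_pairing_le[OF S_space_diff[OF \<eta> \<xi>]])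
      also have "\<dots> \<le> 2 * C * \<epsilon>"
        using close C by (intro mult_left_mono) auto
      also have "\<dots> < (2 * C + 1) * \<epsilon>" using \<epsilon> by (simp add: distrib_right)
      also have "\<dots> = e" using C by (simp add: \<epsilon>_def)
      finally show "dist (dual_pairing F \<eta>) (dual_pairing F \<xi>) < e" .
    qed
    ultimately show "\<exists>T. openin (S_topology P M) T \<and> \<xi> \<in> T
        \<and> T \<subseteq> {\<xi> \<in> S_space P M. dual_pairing F \<xi> \<in> U}"
      by (intro exI[of _ T]) (auto simp: T_def)
  qed
qed

lemma dual_pairing_in_gen_functionals: "dual_pairing F \<in> gen_functionals P M"
  using dual_pairing_add dual_pairing_cmult continuous_map_dual_pairing
  by (auto simp: gen_functionals_def dual_pairing_def)

end

lemma fock_transform_dual_pairing: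
  assumes "\<sigma> \<in> fin_subsets"
  shows "fock_transform M (dual_pairing F) \<sigma> = F \<sigma>"
proof -
  have \<sigma>: "finite \<sigma>" using assms by (simp add: fin_subsets_def)
  have "((\<lambda>\<tau>. F \<tau> * coeff \<tau> (Z_prod M \<sigma>)) has_sum F \<sigma>) fin_subsets"
    using assms by (intro has_sum_finite_neutralI[of "{\<sigma>}"]) (auto simp: fin_subsets_def Z_prod_orthonormal)
  then show ?thesis
    using Z_prod_in_S_space[OF \<sigma>] by (simp add: fock_transform_def dual_pairing_def infsumI)
qed

end

theorem theorem4p3:
  fixes P :: "'a measure" and M :: "nat \<Rightarrow> 'a \<Rightarrow> real"
    and F :: "nat set \<Rightarrow> complex" and C p :: real
  assumes "prob_space P"
    and "normal_martingale P M"
    and "chaotic_representation P M"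
    and "C \<ge> 0" and "p \<ge> 0"
    and "\<forall>\<sigma>\<in>fin_subsets. cmod (F \<sigma>) \<le> C * weight \<sigma> powr p"
  shows "\<exists>!\<Phi>. \<Phi> \<in> gen_functionals P M \<and> (\<forall>\<sigma>\<in>fin_subsets. F \<sigma> = fock_transform M \<Phi> \<sigma>)"
proof -
  interpret prob_space P by fact
  interpret normal_martingale_space P M by unfold_locales fact
  show ?thesis
  proof (rule ex1I[of _ "dual_pairing F"])
    show "dual_pairing F \<in> gen_functionals P M
        \<and> (\<forall>\<sigma>\<in>fin_subsets. F \<sigma> = fock_transform M (dual_pairing F) \<sigma>)"
      using dual_pairing_in_gen_functionals[OF assms(4-6)] by (simp add: fock_transform_dual_pairing)
    fix \<Psi> assume "\<Psi> \<in> gen_functionals P M \<and> (\<forall>\<sigma>\<in>fin_subsets. F \<sigma> = fock_transform M \<Psi> \<sigma>)"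
    then show "\<Psi> = dual_pairing F"
      using dual_pairing_in_gen_functionals[OF assms(4-6)]
      by (intro gen_functional_eqI) (simp_all add: fock_transform_dual_pairing)
  qed
qed

end
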